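(* Let $\Sigma$ be an intrinsic surface of revolution with twist function $\alpha$. Assume that $\alpha$ is not identically equal to $0$ or any other integral multiple of $\pi/2$ on any open interval. Assume furthermore that the surface has no (nonempty) open set of umbilic points. Then $\Sigma$ has constant mean curvature, and the twist function is linear: $\alpha(v)=a v$ for a constant $a$.
   Context: Surfaces are three times continuously differentiable surfaces in Euclidean space $\mathbb{R}^3$, parametrized by coordinates $(u,v)$ with $u$ in an open interval and $v\in\mathbb{R}$. An intrinsic surface of revolution is a surface whose first fundamental form is $I_\rho=\rho(u)^2\begin{pmatrix}1&0\\0&1\end{pmatrix}$ in these coordinates, where $\rho(u)$ is a positive function of $u$ alone. Let $R^{\theta}=\begin{pmatrix}\cos\theta&-\sin\theta\\ \sin\theta&\cos\theta\end{pmatrix}$ denote the counterclockwise rotation by $\theta$. For a $C^1$ function $\alpha:\mathbb{R}\to\mathbb{R}$, a surface has twist (function) $\alpha$ if its shape operator, written as a matrix in the coordinates $(u,v)$, is of the form $$S=R^{-\alpha(v)}\begin{pmatrix}\lambda_1(u)&0\\0&\lambda_2(u)\end{pmatrix}R^{\alpha(v)},$$ where the principal curvatures $\lambda_1,\lambda_2$ are functions of $u$ alone. The mean curvature is normalized as $H=\lambda_1+\lambda_2$. A point is umbilic if $\lambda_1=\lambda_2$ there.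
   Formalization: The conclusion "α(v)=av" is replaced by α(v)=av+α(0), since as stated it fails for a circular cylinder in isometric coordinates rotated by π/4 (constant twist ±π/4) and under translations of v; when α(0)=0 it is the stated formula. *)

theory Defs
  imports "HOL-Analysis.Analysis"
begin

definition partial_u :: "(real \<times> real \<Rightarrow> 'a::real_normed_vector) \<Rightarrow> real \<times> real \<Rightarrow> 'a" where
  "partial_u f p = frechet_derivative f (at p) (1, 0)"

definition partial_v :: "(real \<times> real \<Rightarrow> 'a::real_normed_vector) \<Rightarrow> real \<times> real \<Rightarrow> 'a" where
  "partial_v f p = frechet_derivative f (at p) (0, 1)"

text \<open>Only meant for open \<open>D\<close>, since the derivatives are taken at full neighbourhoods.\<close>

primrec Ck_on :: "nat \<Rightarrow> (real \<times> real \<Rightarrow> 'a::real_normed_vector) \<Rightarrow> (real \<times> real) set \<Rightarrow> bool" where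
  "Ck_on 0 f D \<longleftrightarrow> continuous_on D f"
| "Ck_on (Suc k) f D \<longleftrightarrow>
     (\<forall>p\<in>D. f differentiable (at p)) \<and> Ck_on k (partial_u f) D \<and> Ck_on k (partial_v f) D"

text \<open>A surface is an immersed one: injectivity of \<open>X\<close> is not required, since \<open>v\<close> ranges over
  all reals and a surface of revolution is periodic in \<open>v\<close>.\<close>

definition parametrized_surface :: "(real \<times> real \<Rightarrow> real^3) \<Rightarrow> real set \<Rightarrow> bool" where
  "parametrized_surface X I \<longleftrightarrow>
     open I \<and> is_interval I \<and> I \<noteq> {} \<and>
     Ck_on 3 X (I \<times> UNIV) \<and>
     (\<forall>p \<in> I \<times> UNIV. cross3 (partial_u X p) (partial_v X p) \<noteq> 0)"

definition first_fundamental_form :: "(real \<times> real \<Rightarrow> real^3) \<Rightarrow> real \<times> real \<Rightarrow> real^2^2" where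
  "first_fundamental_form X p =
     vector [vector [partial_u X p \<bullet> partial_u X p, partial_u X p \<bullet> partial_v X p],
             vector [partial_v X p \<bullet> partial_u X p, partial_v X p \<bullet> partial_v X p]]"

definition unit_normal :: "(real \<times> real \<Rightarrow> real^3) \<Rightarrow> real \<times> real \<Rightarrow> real^3" where
  "unit_normal X p =
     (let n = cross3 (partial_u X p) (partial_v X p) in (1 / norm n) *\<^sub>R n)"

text \<open>\<open>S\<close> is the matrix of the shape operator \<open>- dN\<close> in the coordinate basis \<open>(X\<^sub>u, X\<^sub>v)\<close>; the
  columns of \<open>S\<close> are the coordinates of \<open>- N\<^sub>u\<close> and \<open>- N\<^sub>v\<close>. For an immersion \<open>S\<close> is unique.\<close>

definition is_shape_operator :: "(real \<times> real \<Rightarrow> real^3) \<Rightarrow> real \<times> real \<Rightarrow> real^2^2 \<Rightarrow> bool" where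
  "is_shape_operator X p S \<longleftrightarrow>
     - partial_u (unit_normal X) p = (S$1$1) *\<^sub>R partial_u X p + (S$2$1) *\<^sub>R partial_v X p \<and>
     - partial_v (unit_normal X) p = (S$1$2) *\<^sub>R partial_u X p + (S$2$2) *\<^sub>R partial_v X p"

definition intrinsic_surface_of_revolution ::
    "(real \<times> real \<Rightarrow> real^3) \<Rightarrow> real set \<Rightarrow> (real \<Rightarrow> real) \<Rightarrow> bool" where
  "intrinsic_surface_of_revolution X I \<rho> \<longleftrightarrow>
     parametrized_surface X I \<and>
     (\<forall>u\<in>I. \<rho> u > 0) \<and>
     (\<forall>u\<in>I. \<forall>v. first_fundamental_form X (u, v) = (\<rho> u)\<^sup>2 *\<^sub>R mat 1)"

definition rot :: "real \<Rightarrow> real^2^2" where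
  "rot \<theta> = vector [vector [cos \<theta>, - sin \<theta>], vector [sin \<theta>, cos \<theta>]]"

definition diag2 :: "real \<Rightarrow> real \<Rightarrow> real^2^2" where
  "diag2 a b = vector [vector [a, 0], vector [0, b]]"

text \<open>The principal curvatures \<open>\<kappa>1\<close>, \<open>\<kappa>2\<close> are kept as parameters so that umbilic points and
  the mean curvature can be expressed through them.\<close>

definition has_twist ::
    "(real \<times> real \<Rightarrow> real^3) \<Rightarrow> real set \<Rightarrow> (real \<Rightarrow> real) \<Rightarrow> (real \<Rightarrow> real) \<Rightarrow> (real \<Rightarrow> real) \<Rightarrow> bool" where
  "has_twist X I \<alpha> \<kappa>1 \<kappa>2 \<longleftrightarrow>
     \<alpha> C1_differentiable_on UNIV \<and>
     (\<forall>u\<in>I. \<forall>v. is_shape_operator X (u, v) (rot (- \<alpha> v) ** diag2 (\<kappa>1 u) (\<kappa>2 u) ** rot (\<alpha> v)))"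

text \<open>Normalized as the sum, not the average, of the principal curvatures.\<close>

definition mean_curvature :: "(real \<Rightarrow> real) \<Rightarrow> (real \<Rightarrow> real) \<Rightarrow> real \<Rightarrow> real" where
  "mean_curvature \<kappa>1 \<kappa>2 u = \<kappa>1 u + \<kappa>2 u"

definition umbilic :: "(real \<Rightarrow> real) \<Rightarrow> (real \<Rightarrow> real) \<Rightarrow> real \<times> real \<Rightarrow> bool" where
  "umbilic \<kappa>1 \<kappa>2 p \<longleftrightarrow> \<kappa>1 (fst p) = \<kappa>2 (fst p)"

end

theory Submission
  imports Defs
begin

text \<open>
  The theorem is a consequence of the Codazzi equations.

  Put \<open>r = \<rho>\<^sup>2\<close>, \<open>H = \<kappa>1 + \<kappa>2\<close> and \<open>Q = r (\<kappa>1 - \<kappa>2)\<close>. By the double-angle formulas, the matrix of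
  the shape operator is half the sum of \<open>H\<close> times the identity and of \<open>\<kappa>1 - \<kappa>2\<close> times the
  reflection with diagonal \<open>cos 2\<alpha>\<close>, \<open>- cos 2\<alpha>\<close> and off-diagonal entries \<open>- sin 2\<alpha>\<close>; the second
  fundamental form is \<open>r\<close> times that matrix. In isothermal coordinates whose conformal factor
  depends on \<open>u\<close> only, the Codazzi equations (\<open>codazzi_isothermal\<close>) therefore read
  (\<open>codazzi_twisted\<close>)

    \<open>sin 2\<alpha>(v) (Q'(u) - 2 Q(u) \<alpha>'(v)) = 0\<close>   and
    \<open>cos 2\<alpha>(v) (Q'(u) - 2 Q(u) \<alpha>'(v)) = r(u) H'(u)\<close>.

  If \<open>sin 2\<alpha>\<close> vanished identically, \<open>\<alpha>\<close> would be constant, equal to an integral multiple of \<open>\<pi>/2\<close>.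
  So \<open>sin 2\<alpha>(v1) \<noteq> 0\<close> for some \<open>v1\<close>. The first equation at \<open>v1\<close> makes the bracket vanish there for
  every \<open>u\<close>, and the second one, whose right-hand side does not involve \<open>v\<close>, then gives \<open>H' = 0\<close> on
  all of \<open>I\<close>. Now both left-hand sides are zero, and since sine and cosine have no common zero,
  \<open>Q' = 2 Q \<alpha>'(v)\<close> for all \<open>u\<close> and \<open>v\<close>. At a \<open>u\<close> whose points are not umbilic, \<open>Q(u) \<noteq> 0\<close>, so \<open>\<alpha>'\<close>
  is constant.

  The principal curvatures are arbitrary functions of \<open>u\<close> to begin with. Their combinations \<open>r H\<close> and
  \<open>Q\<close> inherit differentiability from the entries of the second fundamental form: the former
  is its trace, the latter is its off-diagonal entry at \<open>v1\<close> up to a nonzero factor.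
\<close>

section \<open>Partial derivatives as derivatives in one variable\<close>

lemma differentiable_imp_has_derivative_partials:
  assumes "f differentiable (at p)"
  shows "(f has_derivative (\<lambda>h. fst h *\<^sub>R partial_u f p + snd h *\<^sub>R partial_v f p)) (at p)"
proof -
  let ?F = "frechet_derivative f (at p)"
  have D: "(f has_derivative ?F) (at p)"
    using assms frechet_derivative_works by blast
  then interpret linear ?F
    using has_derivative_linear by blast
  have "?F h = fst h *\<^sub>R partial_u f p + snd h *\<^sub>R partial_v f p" for h
  proof -
    have "?F h = ?F (fst h *\<^sub>R (1, 0) + snd h *\<^sub>R (0, 1))"
      by simp
    then show ?thesis
      by (simp only: add scale partial_u_def partial_v_def)
  qed
  with D show ?thesis
    by (metis (no_types, lifting) ext)
qed

lemma has_vector_derivative_partial_u: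
  assumes "f differentiable (at (u, v))"
  shows "((\<lambda>s. f (s, v)) has_vector_derivative partial_u f (u, v)) (at u)"
proof -
  have "((\<lambda>s. (s, v)) has_derivative (\<lambda>h. (h, 0))) (at u)"
    by (auto intro!: derivative_eq_intros)
  from has_derivative_compose[OF this differentiable_imp_has_derivative_partials[OF assms]]
  show ?thesis
    by (simp add: has_vector_derivative_def)
qed

lemma has_vector_derivative_partial_v:
  assumes "f differentiable (at (u, v))"
  shows "((\<lambda>t. f (u, t)) has_vector_derivative partial_v f (u, v)) (at v)"
proof -
  have "((\<lambda>t. (u, t)) has_derivative (\<lambda>h. (0, h))) (at v)"
    by (auto intro!: derivative_eq_intros)
  from has_derivative_compose[OF this differentiable_imp_has_derivative_partials[OF assms]]
  show ?thesis
    by (simp add: has_vector_derivative_def)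
qed

text \<open>Because \<open>partial_u\<close> and \<open>partial_v\<close> evaluate the total derivative, a one-variable derivative
  determines them only where \<open>f\<close> is totally differentiable.\<close>

lemma partial_u_eqI:
  assumes "f differentiable (at (u, v))"
    and "((\<lambda>s. f (s, v)) has_vector_derivative d) (at u)"
  shows "partial_u f (u, v) = d"
  using vector_derivative_unique_at[OF has_vector_derivative_partial_u[OF assms(1)] assms(2)] .

lemma partial_v_eqI:
  assumes "f differentiable (at (u, v))"
    and "((\<lambda>t. f (u, t)) has_vector_derivative d) (at v)"
  shows "partial_v f (u, v) = d"
  using vector_derivative_unique_at[OF has_vector_derivative_partial_v[OF assms(1)] assms(2)] .

lemma partial_const [simp]: "partial_u (\<lambda>q. c) p = 0" "partial_v (\<lambda>q. c) p = 0"
  by (simp_all add: partial_u_def partial_v_def frechet_derivative_const)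

lemma partial_inner:
  fixes f g :: "real \<times> real \<Rightarrow> 'a::real_inner"
  assumes "f differentiable (at p)" "g differentiable (at p)"
  shows "partial_u (\<lambda>q. f q \<bullet> g q) p = f p \<bullet> partial_u g p + partial_u f p \<bullet> g p"
    and "partial_v (\<lambda>q. f q \<bullet> g q) p = f p \<bullet> partial_v g p + partial_v f p \<bullet> g p"
proof -
  obtain u v where p: "p = (u, v)" by (cases p)
  have D: "(\<lambda>q. f q \<bullet> g q) differentiable (at (u, v))"
    using assms by (simp add: p)
  show "partial_u (\<lambda>q. f q \<bullet> g q) p = f p \<bullet> partial_u g p + partial_u f p \<bullet> g p"
    unfolding p using assms p
    by (intro partial_u_eqI[OF D] bounded_bilinear.has_vector_derivative[OF bounded_bilinear_inner]
        has_vector_derivative_partial_u) auto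
  show "partial_v (\<lambda>q. f q \<bullet> g q) p = f p \<bullet> partial_v g p + partial_v f p \<bullet> g p"
    unfolding p using assms p
    by (intro partial_v_eqI[OF D] bounded_bilinear.has_vector_derivative[OF bounded_bilinear_inner]
        has_vector_derivative_partial_v) auto
qed

lemma partial_transform_within_open:
  assumes "f differentiable (at p)" "open D" "p \<in> D" "\<And>q. q \<in> D \<Longrightarrow> f q = g q"
  shows "g differentiable (at p)" "partial_u g p = partial_u f p" "partial_v g p = partial_v f p"
proof -
  show "g differentiable (at p)"
    using assms has_derivative_transform_within_open[of f _ p UNIV D g]
    unfolding differentiable_def by blast
  show "partial_u g p = partial_u f p" "partial_v g p = partial_v f p"
    using frechet_derivative_transform_within_open[OF assms(1-3), of g] assms(4)
    by (simp_all add: partial_u_def partial_v_def)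
qed

lemma Ck_on_2D:
  assumes "Ck_on 2 f D" "p \<in> D"
  shows "f differentiable (at p)" "partial_u f differentiable (at p)"
    "partial_v f differentiable (at p)"
    "continuous_on D (partial_v (partial_u f))" "continuous_on D (partial_u (partial_v f))"
  using assms by (auto simp: numeral_eq_Suc)

section \<open>Symmetry of second derivatives\<close>

text \<open>Two applications of the mean value theorem, first in the first variable to the increment of
  \<open>f\<close> in the second one, then in the second variable to \<open>fu\<close>.\<close>

lemma second_difference_eq:
  fixes f fu fuv :: "real \<times> real \<Rightarrow> real"
  assumes "h > 0"
    and box: "{a..a + h} \<times> {b..b + h} \<subseteq> D"
    and fu: "\<And>x y. (x, y) \<in> D \<Longrightarrow> ((\<lambda>s. f (s, y)) has_real_derivative fu (x, y)) (at x)"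
    and fuv: "\<And>x y. (x, y) \<in> D \<Longrightarrow> ((\<lambda>t. fu (x, t)) has_real_derivative fuv (x, y)) (at y)"
  obtains x y where "x \<in> {a..a + h}" "y \<in> {b..b + h}"
    "f (a + h, b + h) - f (a + h, b) - f (a, b + h) + f (a, b) = h\<^sup>2 * fuv (x, y)"
proof -
  have "\<exists>x>a. x < a + h \<and> (f (a + h, b + h) - f (a + h, b)) - (f (a, b + h) - f (a, b))
      = (a + h - a) * (fu (x, b + h) - fu (x, b))"
    by (rule MVT2[of a "a + h" "\<lambda>s. f (s, b + h) - f (s, b)"])
      (use assms(1) box in \<open>auto intro!: DERIV_diff fu\<close>)
  then obtain x where x: "a < x" "x < a + h"
    "(f (a + h, b + h) - f (a + h, b)) - (f (a, b + h) - f (a, b)) = h * (fu (x, b + h) - fu (x, b))"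
    by auto
  have "\<exists>y>b. y < b + h \<and> fu (x, b + h) - fu (x, b) = (b + h - b) * fuv (x, y)"
    by (rule MVT2[of b "b + h" "\<lambda>t. fu (x, t)"]) (use assms(1) box x in \<open>auto intro!: fuv\<close>)
  then obtain y where y: "b < y" "y < b + h" "fu (x, b + h) - fu (x, b) = h * fuv (x, y)"
    by auto
  show ?thesis
    by (rule that[of x y]) (use x y in \<open>auto simp: power2_eq_square algebra_simps\<close>)
qed

text \<open>On small squares at \<open>(a, b)\<close> the same second difference is \<open>h\<^sup>2\<close> times a value of either mixed
  derivative at a nearby point, so by continuity the two cannot differ at \<open>(a, b)\<close>.\<close>

lemma mixed_partials_eq_real:
  fixes f fu fv fuv fvu :: "real \<times> real \<Rightarrow> real"
  assumes "open D" "(a, b) \<in> D"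
    and fu: "\<And>x y. (x, y) \<in> D \<Longrightarrow> ((\<lambda>s. f (s, y)) has_real_derivative fu (x, y)) (at x)"
    and fv: "\<And>x y. (x, y) \<in> D \<Longrightarrow> ((\<lambda>t. f (x, t)) has_real_derivative fv (x, y)) (at y)"
    and fuv: "\<And>x y. (x, y) \<in> D \<Longrightarrow> ((\<lambda>t. fu (x, t)) has_real_derivative fuv (x, y)) (at y)"
    and fvu: "\<And>x y. (x, y) \<in> D \<Longrightarrow> ((\<lambda>s. fv (s, y)) has_real_derivative fvu (x, y)) (at x)"
    and cont: "continuous_on D fuv" "continuous_on D fvu"
  shows "fuv (a, b) = fvu (a, b)"
proof (rule ccontr)
  assume "fuv (a, b) \<noteq> fvu (a, b)"
  define e where "e = \<bar>fuv (a, b) - fvu (a, b)\<bar> / 2"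
  have "e > 0"
    using \<open>fuv (a, b) \<noteq> fvu (a, b)\<close> by (simp add: e_def)
  have "isCont fuv (a, b)" "isCont fvu (a, b)"
    using cont assms(1,2) continuous_on_eq_continuous_at by blast+
  then have "\<forall>\<^sub>F p in nhds (a, b). dist (fuv p) (fuv (a, b)) < e"
    "\<forall>\<^sub>F p in nhds (a, b). dist (fvu p) (fvu (a, b)) < e"
    using \<open>e > 0\<close> by (auto simp: isCont_def tendsto_iff eventually_nhds_conv_at)
  moreover have "\<forall>\<^sub>F p in nhds (a, b). p \<in> D"
    using assms(1,2) by (rule eventually_nhds_in_open)
  ultimately have "\<forall>\<^sub>F p in nhds (a, b). p \<in> D \<and> dist (fuv p) (fuv (a, b)) < e
      \<and> dist (fvu p) (fvu (a, b)) < e"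
    by eventually_elim simp
  then obtain d where "d > 0" and d: "\<And>p. dist p (a, b) < d \<Longrightarrow>
      p \<in> D \<and> dist (fuv p) (fuv (a, b)) < e \<and> dist (fvu p) (fvu (a, b)) < e"
    unfolding eventually_nhds_metric by blast
  define h where "h = d / 3"
  have h: "h > 0" using \<open>d > 0\<close> by (simp add: h_def)
  have near: "dist (x, y) (a, b) < d" if "x \<in> {a..a + h}" "y \<in> {b..b + h}" for x y
  proof -
    have "dist (x, y) (a, b) \<le> \<bar>x - a\<bar> + \<bar>y - b\<bar>"
      using sqrt_sum_squares_le_sum_abs[of "x - a" "y - b"] by (simp add: dist_Pair_Pair dist_real_def)
    also have "\<dots> < d" using that \<open>d > 0\<close> by (auto simp: h_def)
    finally show ?thesis .
  qed
  have box: "{a..a + h} \<times> {b..b + h} \<subseteq> D"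
    using near d by auto
  obtain x y where xy: "x \<in> {a..a + h}" "y \<in> {b..b + h}"
    "f (a + h, b + h) - f (a + h, b) - f (a, b + h) + f (a, b) = h\<^sup>2 * fuv (x, y)"
    by (rule second_difference_eq[OF h box fu fuv])
  \<comment> \<open>The second difference is symmetric in the two variables, so it can also be expanded in the
    other order.\<close>
  have box': "{b..b + h} \<times> {a..a + h} \<subseteq> {q. prod.swap q \<in> D}"
    using box by auto
  obtain y' x' where xy': "y' \<in> {b..b + h}" "x' \<in> {a..a + h}"
    "f (a + h, b + h) - f (a, b + h) - f (a + h, b) + f (a, b) = h\<^sup>2 * fvu (x', y')"
    using second_difference_eq[OF h box', of "f \<circ> prod.swap" "fv \<circ> prod.swap" "fvu \<circ> prod.swap"]
      fv fvu by auto
  have "fuv (x, y) = fvu (x', y')"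
  proof -
    have "h\<^sup>2 * fuv (x, y) = h\<^sup>2 * fvu (x', y')"
      using xy(3) xy'(3) by linarith
    with h show ?thesis by simp
  qed
  moreover have "dist (fuv (x, y)) (fuv (a, b)) < e" "dist (fvu (x', y')) (fvu (a, b)) < e"
    using d near xy xy' by auto
  ultimately show False
    using dist_triangle_half_r[of "fuv (x, y)" "fuv (a, b)" "2 * e" "fvu (a, b)"]
    by (simp add: e_def dist_real_def)
qed

text \<open>A vector is determined by its inner products with all vectors, which reduces the claim to
  real-valued functions.\<close>

lemma mixed_partials_commute:
  fixes f :: "real \<times> real \<Rightarrow> 'a::real_inner"
  assumes "open D" "Ck_on 2 f D" "p \<in> D"
  shows "partial_v (partial_u f) p = partial_u (partial_v f) p"
proof -
  note C = Ck_on_2D[OF assms(2)]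
  obtain a b where p: "p = (a, b)" by (cases p)
  have inner_const: "((\<lambda>s. g s \<bullet> c) has_real_derivative d \<bullet> c) (at s)"
    if "(g has_vector_derivative d) (at s)" for g :: "real \<Rightarrow> 'a" and d c s
    using bounded_linear.has_vector_derivative[OF bounded_linear_inner_left that]
    by (simp add: has_real_derivative_iff_has_vector_derivative)
  have "partial_v (partial_u f) (a, b) \<bullet> c = partial_u (partial_v f) (a, b) \<bullet> c" for c
    by (rule mixed_partials_eq_real[of D a b "\<lambda>q. f q \<bullet> c" "\<lambda>q. partial_u f q \<bullet> c"
          "\<lambda>q. partial_v f q \<bullet> c"])
      (use assms p C in \<open>auto intro!: inner_const has_vector_derivative_partial_u
          has_vector_derivative_partial_v continuous_intros\<close>)
  then show ?thesis
    unfolding p using vector_eq_rdot by blast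
qed

section \<open>The Codazzi equations in isothermal coordinates\<close>

lemma differentiable_cross3:
  fixes f g :: "real \<times> real \<Rightarrow> real^3"
  assumes "f differentiable (at p)" "g differentiable (at p)"
  shows "(\<lambda>q. cross3 (f q) (g q)) differentiable (at p)"
  using assms bounded_bilinear.FDERIV[OF bilinear_conv_bounded_bilinear[THEN iffD1, OF bilinear_cross]]
  unfolding differentiable_def by blast

lemma unit_normal_differentiable:
  assumes "partial_u X differentiable (at p)" "partial_v X differentiable (at p)"
    and "cross3 (partial_u X p) (partial_v X p) \<noteq> 0"
  shows "unit_normal X differentiable (at p)"
proof -
  let ?c = "\<lambda>q. cross3 (partial_u X q) (partial_v X q)"
  have c: "?c differentiable (at p)"
    by (rule differentiable_cross3[OF assms(1,2)])
  have "(\<lambda>q. norm (?c q)) differentiable (at p)"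
    using differentiable_compose[OF differentiable_norm_at[OF assms(3)] c] .
  with c assms(3) have "(\<lambda>q. inverse (norm (?c q)) *\<^sub>R ?c q) differentiable (at p)"
    by (intro differentiable_scaleR differentiable_inverse) auto
  then show ?thesis
    by (simp add: unit_normal_def[abs_def] Let_def inverse_eq_divide)
qed

lemma unit_normal_orthogonal:
  "unit_normal X p \<bullet> partial_u X p = 0" "unit_normal X p \<bullet> partial_v X p = 0"
  by (simp_all add: unit_normal_def Let_def dot_cross_self)

text \<open>With \<open>n\<close> the unit normal, the second fundamental form has entries \<open>X\<^sub>u\<^sub>u \<bullet> n\<close>, \<open>X\<^sub>u\<^sub>v \<bullet> n\<close>,
  \<open>X\<^sub>v\<^sub>v \<bullet> n\<close>, and equals \<open>r\<close> times the matrix \<open>S\<close>. Differentiating each entry once more produces third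
  derivatives of \<open>X\<close>, which cancel in the two differences below because mixed derivatives commute, and
  products of second derivatives of \<open>X\<close> with the derivatives of \<open>n\<close>. The latter are tangential, so
  only the tangential parts of the second derivatives of \<open>X\<close> matter; these are the Christoffel symbols,
  obtained by differentiating the first fundamental form.\<close>

lemma codazzi_isothermal:
  fixes S :: "real \<times> real \<Rightarrow> real^2^2"
  assumes surf: "intrinsic_surface_of_revolution X I \<rho>"
    and shape: "\<forall>p \<in> I \<times> UNIV. is_shape_operator X p (S p)"
    and p: "p \<in> I \<times> UNIV"
  defines "r \<equiv> \<lambda>q. (\<rho> (fst q))\<^sup>2"
  shows "r differentiable (at p)"
    and "(\<lambda>q. r q * S q $ 1 $ 1) differentiable (at p)"
    and "(\<lambda>q. r q * S q $ 1 $ 2) differentiable (at p)"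
    and "(\<lambda>q. r q * S q $ 2 $ 2) differentiable (at p)"
    and "partial_v (\<lambda>q. r q * S q $ 1 $ 1) p = partial_u (\<lambda>q. r q * S q $ 1 $ 2) p"
    and "partial_u (\<lambda>q. r q * S q $ 2 $ 2) p - partial_v (\<lambda>q. r q * S q $ 1 $ 2) p
      = partial_u r p * (S p $ 1 $ 1 + S p $ 2 $ 2) / 2"
proof -
  define D where "D = I \<times> (UNIV :: real set)"
  define E where "E = partial_u X"
  define F where "F = partial_v X"
  define n where "n = unit_normal X"
  define Eu where "Eu = partial_u E"
  define Ev where "Ev = partial_v E"
  define Fu where "Fu = partial_u F"
  define Fv where "Fv = partial_v F"
  define nu where "nu = partial_u n"
  define nv where "nv = partial_v n"
  note defs = E_def F_def n_def Eu_def Ev_def Fu_def Fv_def nu_def nv_def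
  have oD: "open D" and pD: "p \<in> D"
    using surf p by (auto simp: D_def intrinsic_surface_of_revolution_def parametrized_surface_def
        intro: open_Times)
  have C3: "Ck_on 3 X D"
    using surf by (simp add: D_def intrinsic_surface_of_revolution_def parametrized_surface_def)
  have C2: "Ck_on 2 X D" "Ck_on 2 E D" "Ck_on 2 F D"
    using C3 by (auto simp: numeral_eq_Suc E_def F_def intro!: continuous_at_imp_continuous_on
        differentiable_imp_continuous_within)
  have dif: "E differentiable (at q)" "F differentiable (at q)" "Eu differentiable (at q)"
    "Ev differentiable (at q)" "Fu differentiable (at q)" "Fv differentiable (at q)" if "q \<in> D" for q
    using Ck_on_2D[OF C2(2) that] Ck_on_2D[OF C2(3) that] by (simp_all add: defs)
  have ndif: "n differentiable (at q)" if "q \<in> D" for q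
    using surf that dif[OF that]
    by (auto simp: D_def n_def E_def F_def intrinsic_surface_of_revolution_def
        parametrized_surface_def intro!: unit_normal_differentiable)
  have EvFu: "Ev q = Fu q" if "q \<in> D" for q
    using mixed_partials_commute[OF oD C2(1) that] by (simp add: defs)
  have Euv: "partial_v Eu p = partial_u Ev p" and Fuv: "partial_v Fu p = partial_u Fv p"
    using mixed_partials_commute[OF oD C2(2) pD] mixed_partials_commute[OF oD C2(3) pD]
    by (simp_all add: defs)
  have I: "E q \<bullet> E q = r q" "E q \<bullet> F q = 0" "F q \<bullet> E q = 0" "F q \<bullet> F q = r q" if "q \<in> D" for q
  proof -
    have "first_fundamental_form X q = (\<rho> (fst q))\<^sup>2 *\<^sub>R mat 1"
      using surf that by (auto simp: D_def intrinsic_surface_of_revolution_def)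
    then show "E q \<bullet> E q = r q" "E q \<bullet> F q = 0" "F q \<bullet> E q = 0" "F q \<bullet> F q = r q"
      by (simp_all add: first_fundamental_form_def vec_eq_iff forall_2 mat_def r_def E_def F_def)
  qed
  \<comment> \<open>Every identity between functions on \<open>D\<close> may be differentiated at \<open>p\<close>, provided one side is
    known to be differentiable.\<close>
  note tr = partial_transform_within_open[OF _ oD pD]
  show rd: "r differentiable (at p)"
    using tr(1)[of "\<lambda>q. E q \<bullet> E q" r] dif[OF pD] I by simp
  have rv: "partial_v r p = 0"
    using partial_v_eqI[of r "fst p" "snd p" 0] rd by (simp add: r_def)
  \<comment> \<open>The Christoffel symbols, up to the factor \<open>r\<close>.\<close>
  have EE: "2 * (E p \<bullet> Eu p) = partial_u r p" "E p \<bullet> Ev p = 0"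
    using tr(2,3)[of "\<lambda>q. E q \<bullet> E q" r] dif[OF pD] I rv partial_inner[of E p E]
    by (simp_all add: defs inner_commute)
  have FF: "2 * (F p \<bullet> Fu p) = partial_u r p" "F p \<bullet> Fv p = 0"
    using tr(2,3)[of "\<lambda>q. F q \<bullet> F q" r] dif[OF pD] I rv partial_inner[of F p F]
    by (simp_all add: defs inner_commute)
  have EF: "E p \<bullet> Fu p + Eu p \<bullet> F p = 0" "E p \<bullet> Fv p + Ev p \<bullet> F p = 0"
    using tr(2,3)[of "\<lambda>q. E q \<bullet> F q" "\<lambda>q. 0"] dif[OF pD] I partial_inner[of E p F]
    by (simp_all add: defs)
  \<comment> \<open>Differentiating the orthogonality relations expresses the second fundamental form by the
    second derivatives of the parametrization.\<close>
  have II: "r q * S q $ 1 $ 1 = Eu q \<bullet> n q" "r q * S q $ 1 $ 2 = Ev q \<bullet> n q"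
    "r q * S q $ 1 $ 2 = Fu q \<bullet> n q" "r q * S q $ 2 $ 2 = Fv q \<bullet> n q"
    and nuq: "nu q = - (S q $ 1 $ 1 *\<^sub>R E q + S q $ 2 $ 1 *\<^sub>R F q)"
    and nvq: "nv q = - (S q $ 1 $ 2 *\<^sub>R E q + S q $ 2 $ 2 *\<^sub>R F q)" 
    and S21: "r q * S q $ 1 $ 2 = r q * S q $ 2 $ 1"
    if q: "q \<in> D" for q
  proof -
    have sh: "- nu q = S q $ 1 $ 1 *\<^sub>R E q + S q $ 2 $ 1 *\<^sub>R F q"
      "- nv q = S q $ 1 $ 2 *\<^sub>R E q + S q $ 2 $ 2 *\<^sub>R F q"
      using bspec[OF shape, of q] q by (simp_all add: D_def is_shape_operator_def defs)
    then show nq: "nu q = - (S q $ 1 $ 1 *\<^sub>R E q + S q $ 2 $ 1 *\<^sub>R F q)"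
      "nv q = - (S q $ 1 $ 2 *\<^sub>R E q + S q $ 2 $ 2 *\<^sub>R F q)"
      by (metis minus_minus)+
    have "n q \<bullet> E q = 0" "n q \<bullet> F q = 0" for q
      by (simp_all add: n_def E_def F_def unit_normal_orthogonal)
    then have "n q \<bullet> Eu q + nu q \<bullet> E q = 0" "n q \<bullet> Ev q + nv q \<bullet> E q = 0"
      "n q \<bullet> Fu q + nu q \<bullet> F q = 0" "n q \<bullet> Fv q + nv q \<bullet> F q = 0"
      using partial_inner[of n q E] partial_inner[of n q F] dif[OF q] ndif[OF q]
      by (simp_all add: Eu_def Ev_def Fu_def Fv_def nu_def nv_def)
    then show "r q * S q $ 1 $ 1 = Eu q \<bullet> n q" "r q * S q $ 1 $ 2 = Ev q \<bullet> n q"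
      "r q * S q $ 1 $ 2 = Fu q \<bullet> n q" "r q * S q $ 2 $ 2 = Fv q \<bullet> n q"
      "r q * S q $ 1 $ 2 = r q * S q $ 2 $ 1"
      using I[OF q] EvFu[OF q]
      by (simp_all add: nq inner_add_left inner_diff_left inner_commute[of "n q"] mult.commute[of "r q"])
  qed
  have d: "(\<lambda>q. Eu q \<bullet> n q) differentiable (at p)" "(\<lambda>q. Ev q \<bullet> n q) differentiable (at p)"
    "(\<lambda>q. Fu q \<bullet> n q) differentiable (at p)" "(\<lambda>q. Fv q \<bullet> n q) differentiable (at p)"
    using dif[OF pD] ndif[OF pD] by simp_all
  show "(\<lambda>q. r q * S q $ 1 $ 1) differentiable (at p)"
    "(\<lambda>q. r q * S q $ 1 $ 2) differentiable (at p)"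
    "(\<lambda>q. r q * S q $ 2 $ 2) differentiable (at p)"
    using tr(1)[OF d(1)] tr(1)[OF d(2)] tr(1)[OF d(4)] II by simp_all
  \<comment> \<open>The off-diagonal entry has two expressions; for each equation the one is chosen whose third
    derivative matches that of the diagonal entry.\<close>
  have Lv: "partial_v (\<lambda>q. r q * S q $ 1 $ 1) p = Eu p \<bullet> nv p + partial_v Eu p \<bullet> n p"
    using tr(3)[OF d(1), of "\<lambda>q. r q * S q $ 1 $ 1"] II(1) partial_inner(2)[of Eu p n]
      dif[OF pD] ndif[OF pD] by (simp add: nv_def)
  have Mu: "partial_u (\<lambda>q. r q * S q $ 1 $ 2) p = Ev p \<bullet> nu p + partial_u Ev p \<bullet> n p"
    using tr(2)[OF d(2), of "\<lambda>q. r q * S q $ 1 $ 2"] II(2) partial_inner(1)[of Ev p n]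
      dif[OF pD] ndif[OF pD] by (simp add: nu_def)
  have Mv: "partial_v (\<lambda>q. r q * S q $ 1 $ 2) p = Fu p \<bullet> nv p + partial_v Fu p \<bullet> n p"
    using tr(3)[OF d(3), of "\<lambda>q. r q * S q $ 1 $ 2"] II(3) partial_inner(2)[of Fu p n]
      dif[OF pD] ndif[OF pD] by (simp add: nv_def)
  have Gu: "partial_u (\<lambda>q. r q * S q $ 2 $ 2) p = Fv p \<bullet> nu p + partial_u Fv p \<bullet> n p"
    using tr(2)[OF d(4), of "\<lambda>q. r q * S q $ 2 $ 2"] II(4) partial_inner(1)[of Fv p n]
      dif[OF pD] ndif[OF pD] by (simp add: nu_def)
  have "r p > 0"
    using surf p by (auto simp: r_def intrinsic_surface_of_revolution_def)
  then have S21p: "S p $ 2 $ 1 = S p $ 1 $ 2"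
    using S21[OF pD] by simp
  have nu: "x \<bullet> nu p = - (S p $ 1 $ 1 * (x \<bullet> E p) + S p $ 1 $ 2 * (x \<bullet> F p))"
    and nv: "x \<bullet> nv p = - (S p $ 1 $ 2 * (x \<bullet> E p) + S p $ 2 $ 2 * (x \<bullet> F p))" for x
    unfolding nuq[OF pD] nvq[OF pD] S21p
    by (simp_all only: inner_minus_right inner_add_right inner_scaleR_right)
  note Ev = EvFu[OF pD]
  define d where "d = partial_u r p / 2"
  have coef: "Eu p \<bullet> E p = d" "Eu p \<bullet> F p = 0" "Fu p \<bullet> E p = 0"
    "Fu p \<bullet> F p = d" "Fv p \<bullet> E p = - d" "Fv p \<bullet> F p = 0"
    using EE FF EF Ev by (simp_all add: d_def inner_commute)
  have "Eu p \<bullet> nv p = Ev p \<bullet> nu p"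
    unfolding nu nv Ev coef by simp
  then show "partial_v (\<lambda>q. r q * S q $ 1 $ 1) p = partial_u (\<lambda>q. r q * S q $ 1 $ 2) p"
    unfolding Lv Mu Euv by simp
  have "Fv p \<bullet> nu p - Fu p \<bullet> nv p = d * (S p $ 1 $ 1 + S p $ 2 $ 2)"
    unfolding nu nv coef by (simp add: algebra_simps)
  then show "partial_u (\<lambda>q. r q * S q $ 2 $ 2) p - partial_v (\<lambda>q. r q * S q $ 1 $ 2) p
      = partial_u r p * (S p $ 1 $ 1 + S p $ 2 $ 2) / 2"
    unfolding Gu Mv Fuv d_def by simp
qed

section \<open>The Codazzi equations of a twisted surface\<close>

lemma twisted_shape_operator_entries:
  fixes a b \<theta> :: real
  defines "S \<equiv> rot (- \<theta>) ** diag2 a b ** rot \<theta>"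
  shows "S $ 1 $ 1 = (a + b) / 2 + (a - b) / 2 * cos (2 * \<theta>)"
    and "S $ 1 $ 2 = - ((a - b) / 2 * sin (2 * \<theta>))"
    and "S $ 2 $ 2 = (a + b) / 2 - (a - b) / 2 * cos (2 * \<theta>)"
proof -
  have double: "cos (2 * \<theta>) = cos \<theta> * cos \<theta> - sin \<theta> * sin \<theta>"
    "sin (2 * \<theta>) = 2 * sin \<theta> * cos \<theta>" and one: "sin \<theta> * sin \<theta> + cos \<theta> * cos \<theta> = 1"
    using sin_cos_squared_add[of \<theta>] by (simp_all add: cos_double sin_double power2_eq_square)
  have entries: "S $ 1 $ 1 = a * (cos \<theta> * cos \<theta>) + b * (sin \<theta> * sin \<theta>)"
    "S $ 1 $ 2 = - (a * sin \<theta> * cos \<theta>) + b * sin \<theta> * cos \<theta>"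
    "S $ 2 $ 2 = a * (sin \<theta> * sin \<theta>) + b * (cos \<theta> * cos \<theta>)"
    by (simp_all add: S_def rot_def diag2_def matrix_matrix_mult_def sum_2)
  have half: "cos \<theta> * cos \<theta> = (1 + cos (2 * \<theta>)) / 2" "sin \<theta> * sin \<theta> = (1 - cos (2 * \<theta>)) / 2"
    using double one by simp_all
  show "S $ 1 $ 1 = (a + b) / 2 + (a - b) / 2 * cos (2 * \<theta>)"
    "S $ 2 $ 2 = (a + b) / 2 - (a - b) / 2 * cos (2 * \<theta>)"
    unfolding entries half by (simp_all add: field_simps)
  show "S $ 1 $ 2 = - ((a - b) / 2 * sin (2 * \<theta>))"
    unfolding entries double(2) by (simp add: field_simps)
qed

text \<open>In the twisted case the dependence of the second fundamental form on \<open>u\<close> and on \<open>v\<close> separates,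
  so the partial derivatives become ordinary derivatives of \<open>P\<close>, \<open>Q\<close> and \<open>\<alpha>\<close>. The point \<open>v1\<close> serves to
  recover \<open>Q\<close>, hence its differentiability, from the off-diagonal entry. The last equation contains
  \<open>r H'\<close> in the form \<open>P' - r' H\<close>, since it is \<open>P = r H\<close> that occurs in the second fundamental form.\<close>

lemma codazzi_twisted:
  assumes surf: "intrinsic_surface_of_revolution X I \<rho>"
    and twist: "has_twist X I \<alpha> \<kappa>1 \<kappa>2"
    and u: "u \<in> I"
    and v1: "sin (2 * \<alpha> v1) \<noteq> 0"
    and \<alpha>': "\<And>v. (\<alpha> has_real_derivative \<alpha>' v) (at v)"
  defines "r \<equiv> \<lambda>u. (\<rho> u)\<^sup>2"
  defines "P \<equiv> \<lambda>u. r u * (\<kappa>1 u + \<kappa>2 u)"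
    and "Q \<equiv> \<lambda>u. r u * (\<kappa>1 u - \<kappa>2 u)"
  obtains r' P' Q' where
    "(r has_real_derivative r') (at u)" "(P has_real_derivative P') (at u)"
    "(Q has_real_derivative Q') (at u)"
    "\<And>v. sin (2 * \<alpha> v) * (Q' - 2 * Q u * \<alpha>' v) = 0"
    "\<And>v. P' - cos (2 * \<alpha> v) * (Q' - 2 * Q u * \<alpha>' v) = r' * (\<kappa>1 u + \<kappa>2 u)"
proof -
  define S where "S q = rot (- \<alpha> (snd q)) ** diag2 (\<kappa>1 (fst q)) (\<kappa>2 (fst q)) ** rot (\<alpha> (snd q))"
    for q :: "real \<times> real"
  define R where "R q = (\<rho> (fst q))\<^sup>2" for q :: "real \<times> real"
  have shape: "\<forall>q \<in> I \<times> UNIV. is_shape_operator X q (S q)"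
    using twist by (auto simp: has_twist_def S_def)
  have entries: "R q * S q $ 1 $ 1 = P (fst q) / 2 + Q (fst q) / 2 * cos (2 * \<alpha> (snd q))"
    "R q * S q $ 1 $ 2 = - (Q (fst q) / 2 * sin (2 * \<alpha> (snd q)))"
    "R q * S q $ 2 $ 2 = P (fst q) / 2 - Q (fst q) / 2 * cos (2 * \<alpha> (snd q))" for q
    by (simp_all add: S_def twisted_shape_operator_entries R_def P_def Q_def r_def algebra_simps
        add_divide_distrib diff_divide_distrib)
  have mem: "(u, v) \<in> I \<times> UNIV" for v
    using u by simp
  note cod = codazzi_isothermal[OF surf shape mem]
  have dif: "R differentiable (at (u, v))" "(\<lambda>q. R q * S q $ 1 $ 1) differentiable (at (u, v))"
    "(\<lambda>q. R q * S q $ 1 $ 2) differentiable (at (u, v))"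
    "(\<lambda>q. R q * S q $ 2 $ 2) differentiable (at (u, v))" for v
    unfolding R_def[abs_def] by (rule cod)+
  have eqs: "partial_v (\<lambda>q. R q * S q $ 1 $ 1) (u, v) = partial_u (\<lambda>q. R q * S q $ 1 $ 2) (u, v)"
    "partial_u (\<lambda>q. R q * S q $ 2 $ 2) (u, v) - partial_v (\<lambda>q. R q * S q $ 1 $ 2) (u, v)
      = partial_u R (u, v) * (S (u, v) $ 1 $ 1 + S (u, v) $ 2 $ 2) / 2" for v
    unfolding R_def[abs_def] by (rule cod)+
  have hasu: "((\<lambda>s. f (s, v)) has_real_derivative partial_u f (u, v)) (at u)"
    and hasv: "((\<lambda>t. f (u, t)) has_real_derivative partial_v f (u, v)) (at v)"
    if "f differentiable (at (u, v))" for f v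
    using has_vector_derivative_partial_u[OF that] has_vector_derivative_partial_v[OF that]
    by (simp_all add: has_real_derivative_iff_has_vector_derivative)
  have r: "(r has_real_derivative partial_u R (u, v)) (at u)" for v
  proof -
    have "(\<lambda>s. R (s, v)) = r"
      by (simp add: R_def r_def)
    then show ?thesis
      using hasu[OF dif(1)[of v]] by simp
  qed
  define r' where "r' = partial_u R (u, v1)"
  have r': "(r has_real_derivative r') (at u)" and Ru: "partial_u R (u, v) = r'" for v
    unfolding r'_def using r DERIV_unique by blast+
  define P' where "P' = partial_u (\<lambda>q. R q * S q $ 1 $ 1) (u, v1)
      + partial_u (\<lambda>q. R q * S q $ 2 $ 2) (u, v1)"
  have P': "(P has_real_derivative P') (at u)"
    using DERIV_add[OF hasu[OF dif(2)[of v1]] hasu[OF dif(4)[of v1]]]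
    by (simp add: P'_def entries)
  define Q' where "Q' = - 2 / sin (2 * \<alpha> v1) * partial_u (\<lambda>q. R q * S q $ 1 $ 2) (u, v1)"
  have Q': "(Q has_real_derivative Q') (at u)"
    using DERIV_cmult[OF hasu[OF dif(3)[of v1]], of "- 2 / sin (2 * \<alpha> v1)"] v1
    by (simp add: Q'_def entries)
  have 1: "sin (2 * \<alpha> v) * (Q' - 2 * Q u * \<alpha>' v) = 0" for v
  proof -
    have "((\<lambda>t. P u / 2 + Q u / 2 * cos (2 * \<alpha> t)) has_real_derivative
        - (Q u * sin (2 * \<alpha> v) * \<alpha>' v)) (at v)"
      by (auto intro!: derivative_eq_intros \<alpha>')
    then have "partial_v (\<lambda>q. R q * S q $ 1 $ 1) (u, v) = - (Q u * sin (2 * \<alpha> v) * \<alpha>' v)"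
      using hasv[OF dif(2)[of v]] DERIV_unique by (fastforce simp: entries)
    moreover have "((\<lambda>s. - (Q s / 2 * sin (2 * \<alpha> v))) has_real_derivative
        - (Q' / 2 * sin (2 * \<alpha> v))) (at u)"
      by (auto intro!: derivative_eq_intros Q')
    then have "partial_u (\<lambda>q. R q * S q $ 1 $ 2) (u, v) = - (Q' / 2 * sin (2 * \<alpha> v))"
      using hasu[OF dif(3)[of v]] DERIV_unique by (fastforce simp: entries)
    ultimately show ?thesis
      using eqs(1)[of v] by (simp add: algebra_simps)
  qed
  have 2: "P' - cos (2 * \<alpha> v) * (Q' - 2 * Q u * \<alpha>' v) = r' * (\<kappa>1 u + \<kappa>2 u)" for v
  proof -
    have "((\<lambda>t. - (Q u / 2 * sin (2 * \<alpha> t))) has_real_derivative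
        - (Q u * cos (2 * \<alpha> v) * \<alpha>' v)) (at v)"
      by (auto intro!: derivative_eq_intros \<alpha>')
    then have "partial_v (\<lambda>q. R q * S q $ 1 $ 2) (u, v) = - (Q u * cos (2 * \<alpha> v) * \<alpha>' v)"
      using hasv[OF dif(3)[of v]] DERIV_unique by (fastforce simp: entries)
    moreover have "((\<lambda>s. P s / 2 - Q s / 2 * cos (2 * \<alpha> v)) has_real_derivative
        P' / 2 - Q' / 2 * cos (2 * \<alpha> v)) (at u)"
      by (auto intro!: derivative_eq_intros P' Q')
    then have "partial_u (\<lambda>q. R q * S q $ 2 $ 2) (u, v) = P' / 2 - Q' / 2 * cos (2 * \<alpha> v)"
      using hasu[OF dif(4)[of v]] DERIV_unique by (fastforce simp: entries)
    moreover have "S (u, v) $ 1 $ 1 + S (u, v) $ 2 $ 2 = \<kappa>1 u + \<kappa>2 u"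
      by (simp add: S_def twisted_shape_operator_entries)
    ultimately show ?thesis
      using eqs(2)[of v] Ru[of v] by (simp add: algebra_simps)
  qed
  from r' P' Q' 1 2 show ?thesis
    by (rule that)
qed

section \<open>Constant mean curvature and linear twist\<close>

text \<open>Where \<open>sin 2\<alpha>\<close> vanishes identically, so does its derivative \<open>2 \<alpha>' cos 2\<alpha>\<close>, in which the cosine is
  \<open>\<plusminus> 1\<close>. Hence \<open>\<alpha>\<close> is constant.\<close>

lemma exists_sin_double_twist_nonzero:
  fixes \<alpha> :: "real \<Rightarrow> real"
  assumes \<alpha>': "\<And>v. (\<alpha> has_real_derivative \<alpha>' v) (at v)"
    and ne: "\<not> (\<exists>k::int. \<forall>v\<in>{0<..<1}. \<alpha> v = of_int k * (pi / 2))"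
  obtains v where "sin (2 * \<alpha> v) \<noteq> 0"
proof (rule ccontr)
  assume "\<not> thesis"
  then have s0: "sin (2 * \<alpha> v) = 0" for v
    using that by blast
  have "\<alpha>' v = 0" for v
  proof -
    have "((\<lambda>t. sin (2 * \<alpha> t)) has_real_derivative cos (2 * \<alpha> v) * (2 * \<alpha>' v)) (at v)"
      by (auto intro!: derivative_eq_intros \<alpha>')
    then have "((\<lambda>t. 0) has_real_derivative cos (2 * \<alpha> v) * (2 * \<alpha>' v)) (at v)"
      by (simp only: s0)
    then have "cos (2 * \<alpha> v) * (2 * \<alpha>' v) = 0"
      using DERIV_unique DERIV_const by blast
    then show ?thesis
      using sin_cos_squared_add[of "2 * \<alpha> v"] by (auto simp: s0)
  qed
  then have const: "\<alpha> v = \<alpha> 0" for v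
    using \<alpha>' by (metis DERIV_isconst_all)
  obtain k :: int where "2 * \<alpha> 0 = of_int k * pi"
    using s0[of 0] by (auto simp: sin_zero_iff_int2)
  then have "\<forall>v\<in>{0<..<1}. \<alpha> v = of_int k * (pi / 2)"
    using const by (metis mult_2 field_sum_of_halves mult.commute nonzero_mult_div_cancel_left
        times_divide_eq_right zero_neq_numeral)
  with ne show False by blast
qed

theorem theorem1p3:
  fixes X :: "real \<times> real \<Rightarrow> real^3" and I :: "real set"
    and \<rho> \<alpha> \<kappa>1 \<kappa>2 :: "real \<Rightarrow> real"
  assumes "intrinsic_surface_of_revolution X I \<rho>"
    and "has_twist X I \<alpha> \<kappa>1 \<kappa>2"
    and "\<And>s t :: real. s < t \<Longrightarrow> \<not> (\<exists>k::int. \<forall>v\<in>{s<..<t}. \<alpha> v = of_int k * (pi / 2))"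
    and "\<not> (\<exists>W. open W \<and> W \<noteq> {} \<and> W \<subseteq> I \<times> UNIV \<and> (\<forall>p\<in>W. umbilic \<kappa>1 \<kappa>2 p))"
  shows "(\<exists>H. \<forall>u\<in>I. mean_curvature \<kappa>1 \<kappa>2 u = H) \<and> (\<exists>a. \<forall>v. \<alpha> v = a * v + \<alpha> 0)"
proof -
  obtain \<alpha>' where \<alpha>': "\<And>v. (\<alpha> has_real_derivative \<alpha>' v) (at v)"
    using assms(2) by (auto simp: has_twist_def C1_differentiable_on_def
        has_real_derivative_iff_has_vector_derivative)
  obtain v1 where v1: "sin (2 * \<alpha> v1) \<noteq> 0"
    using exists_sin_double_twist_nonzero[OF \<alpha>' assms(3)] by auto
  have I: "open I" "is_interval I" "I \<noteq> {}" and pos: "\<And>u. u \<in> I \<Longrightarrow> \<rho> u > 0"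
    using assms(1) by (auto simp: intrinsic_surface_of_revolution_def parametrized_surface_def)
  note cod = codazzi_twisted[OF assms(1,2) _ v1 \<alpha>']
  \<comment> \<open>At \<open>v1\<close> the bracket in both Codazzi equations is zero, which leaves \<open>(r H)' = r' H\<close>.\<close>
  have "((\<lambda>u. \<kappa>1 u + \<kappa>2 u) has_real_derivative 0) (at u)" if u: "u \<in> I" for u
  proof (rule cod[OF u])
    fix r' P' Q'
    assume r': "((\<lambda>u. (\<rho> u)\<^sup>2) has_real_derivative r') (at u)"
      and P': "((\<lambda>u. (\<rho> u)\<^sup>2 * (\<kappa>1 u + \<kappa>2 u)) has_real_derivative P') (at u)"
      and 1: "\<And>v. sin (2 * \<alpha> v) * (Q' - 2 * ((\<rho> u)\<^sup>2 * (\<kappa>1 u - \<kappa>2 u)) * \<alpha>' v) = 0"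
      and 2: "\<And>v. P' - cos (2 * \<alpha> v) * (Q' - 2 * ((\<rho> u)\<^sup>2 * (\<kappa>1 u - \<kappa>2 u)) * \<alpha>' v)
          = r' * (\<kappa>1 u + \<kappa>2 u)"
    have P'_eq: "P' = r' * (\<kappa>1 u + \<kappa>2 u)"
      using 1[of v1] 2[of v1] v1 by simp
    have \<rho>: "\<rho> u \<noteq> 0"
      using pos[OF u] by simp
    have "((\<lambda>s. (\<rho> s)\<^sup>2 * (\<kappa>1 s + \<kappa>2 s) / (\<rho> s)\<^sup>2) has_real_derivative 0) (at u)"
      by (rule derivative_eq_intros P' r')+ (use \<rho> in \<open>simp_all add: P'_eq\<close>)
    then show ?thesis
      by (rule has_field_derivative_transform_within_open[OF _ \<open>open I\<close> u])
        (use pos in \<open>force\<close>)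
  qed
  then have H: "\<exists>H. \<forall>u\<in>I. \<kappa>1 u + \<kappa>2 u = H"
    using I(2) by (intro has_field_derivative_zero_constant)
      (auto simp: is_interval_convex has_field_derivative_at_within)
  obtain u0 where u0: "u0 \<in> I" "\<kappa>1 u0 \<noteq> \<kappa>2 u0"
  proof -
    have "open (I \<times> (UNIV :: real set))"
      using I(1) by (simp add: open_Times)
    moreover have "I \<times> (UNIV :: real set) \<noteq> {}"
      using I(3) by simp
    ultimately have "\<exists>p \<in> I \<times> UNIV. \<not> umbilic \<kappa>1 \<kappa>2 p"
      using assms(4) by blast
    then show ?thesis
      using that by (auto simp: umbilic_def)
  qed
  have "\<exists>a. \<forall>v. \<alpha>' v = a"
  proof (rule cod[OF u0(1)])
    fix r' P' Q'
    let ?Q = "(\<rho> u0)\<^sup>2 * (\<kappa>1 u0 - \<kappa>2 u0)"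
    assume 1: "\<And>v. sin (2 * \<alpha> v) * (Q' - 2 * ?Q * \<alpha>' v) = 0"
      and 2: "\<And>v. P' - cos (2 * \<alpha> v) * (Q' - 2 * ?Q * \<alpha>' v) = r' * (\<kappa>1 u0 + \<kappa>2 u0)"
    have "Q' - 2 * ?Q * \<alpha>' v = 0" for v
    proof -
      have "P' = r' * (\<kappa>1 u0 + \<kappa>2 u0)"
        using 1[of v1] 2[of v1] v1 by simp
      then have "cos (2 * \<alpha> v) * (Q' - 2 * ?Q * \<alpha>' v) = 0"
        using 2[of v] by simp
      then show ?thesis
        using 1[of v] sin_zero_abs_cos_one[of "2 * \<alpha> v"] unfolding mult_eq_0_iff by auto
    qed
    moreover have "?Q \<noteq> 0"
      using u0 pos by force
    ultimately have "\<alpha>' v = Q' / (2 * ?Q)" for v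
      by (simp add: field_simps)
    then show ?thesis by blast
  qed
  then obtain a where a: "\<And>v. \<alpha>' v = a" by blast
  have "((\<lambda>v. \<alpha> v - a * v) has_real_derivative 0) (at v)" for v
    using DERIV_diff[OF \<alpha>'[of v] DERIV_cmult_Id[of a]] by (simp add: a)
  then have const: "\<alpha> v - a * v = \<alpha> 0 - a * 0" for v
    using DERIV_isconst_all[of "\<lambda>v. \<alpha> v - a * v" v 0] by simp
  have "\<alpha> v = a * v + \<alpha> 0" for v
    using const[of v] by linarith
  then have "\<exists>a. \<forall>v. \<alpha> v = a * v + \<alpha> 0"
    by blast
  with H show ?thesis
    by (simp add: mean_curvature_def)
qed

end
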